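(* Let $A\in\mathbb{R}^{m\times n}$ have no zero rows, let $b\in\mathbb{R}^m$, and suppose that the feasible region $S=\{x\in\mathbb{R}^n : Ax\le b\}$ is nonempty. Let $\{\mathcal{I}_1,\dots,\mathcal{I}_t\}$ be a partition of $[m]$, put $$\zeta=\max_{1\le i\le t}\frac{\sigma_{\max}^2(A_{\mathcal{I}_i,:})}{\|A_{\mathcal{I}_i,:}\|_F^2},$$ and let $L>0$ be a Hoffman constant for $(A,b)$. Let $w\in(0,2)$, let $x^0\in\mathbb{R}^n$, and let $\{x^k\}_{k=0}^\infty$ be the random sequence generated by the GRABP method started at $x^0$ with the adaptive stepsize $$\alpha_k=w\,\frac{\|(A_{\mathcal{I}_{i_k},:}x^k-b_{\mathcal{I}_{i_k}})_+\|_2^2\,\|A_{\mathcal{I}_{i_k},:}\|_F^2}{\|(A_{\mathcal{I}_{i_k},:})^\top(A_{\mathcal{I}_{i_k},:}x^k-b_{\mathcal{I}_{i_k}})_+\|_2^2},$$ where $i_k$ is the block index selected at iteration $k$. Then for every $k\ge 0$, $$\mathbb{E}\left[\|x^k-P_S(x^k)\|_2^2\right]\le\left(1-\frac{2w-w^2}{\zeta L^2\|A\|_F^2}\right)^k\|x^0-P_S(x^0)\|_2^2 .$$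
   Context: Notation. $[m]=\{1,\dots,m\}$. The inequality $Ax\le b$ is componentwise. $\|\cdot\|_2$ is the Euclidean norm on vectors, $\|\cdot\|_F$ the Frobenius norm, and $\sigma_{\max}(G)$ the largest singular value of $G$. For $v\in\mathbb{R}^d$, $(v)_+$ is the vector with entries $\max\{0,v_j\}$. A partition $\{\mathcal{I}_1,\dots,\mathcal{I}_t\}$ of $[m]$ is a family of nonempty, pairwise disjoint index sets with union $[m]$. $A_{\mathcal{I}_i,:}$ is the row submatrix of $A$ indexed by $\mathcal{I}_i$, and $b_{\mathcal{I}_i}$ is the corresponding subvector of $b$. $P_S(x)$ is the orthogonal projection of $x$ onto the closed convex set $S$. Hoffman constant. By Hoffman's theorem there is a constant $L>0$ such that $\|x-P_S(x)\|_2^2\le L^2\|(Ax-b)_+\|_2^2$ for all $x\in\mathbb{R}^n$; any such $L$ is called a Hoffman constant for $(A,b)$. GRABP method (greedy randomized average block projection), for a fixed partition $\{\mathcal{I}_1,\dots,\mathcal{I}_t\}$ of $[m]$, initial point $x^0$ and stepsizes $\alpha_k$. Given $x^k\notin S$: (1) compute $$\epsilon_k=\frac12\left(\frac{1}{\|(Ax^k-b)_+\|_2^2}\max_{1\le i\le t}\frac{\|(A_{\mathcal{I}_i,:}x^k-b_{\mathcal{I}_i})_+\|_2^2}{\|A_{\mathcal{I}_i,:}\|_F^2}+\frac{1}{\|A\|_F^2}\right);$$ (2) let $\mathcal{U}_k=\{i\in\{1,\dots,t\} : \|(A_{\mathcal{I}_i,:}x^k-b_{\mathcal{I}_i})_+\|_2^2\ge\epsilon_k\|(Ax^k-b)_+\|_2^2\,\|A_{\mathcal{I}_i,:}\|_F^2\}$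 (this set is nonempty); (3) select a random index $i_k$ such that, conditionally on the first $k$ iterations, $i_k=i$ with probability $p_{k,i}$, where $p_{k,i}=0$ for $i\notin\mathcal{U}_k$, $p_{k,i}\ge0$ for $i\in\mathcal{U}_k$, and $\sum_{i\in\mathcal{U}_k}p_{k,i}=1$ (the probabilities are otherwise arbitrary and may depend on the past iterations); (4) set $$x^{k+1}=x^k-\alpha_k\frac{(A_{\mathcal{I}_{i_k},:})^\top(A_{\mathcal{I}_{i_k},:}x^k-b_{\mathcal{I}_{i_k}})_+}{\|A_{\mathcal{I}_{i_k},:}\|_F^2}.$$ If $x^k\in S$, then $x^{k+1}=x^k$. For $x^k\notin S$ and $i_k\in\mathcal{U}_k$ the denominator in the adaptive stepsize is nonzero, so the stepsize is well defined. *)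

theory Defs
  imports "HOL-Probability.Probability"
begin

text \<open>Matrices and vectors are those of HOL-Analysis: the rows are indexed by the finite type
  \<^typ>\<open>'m\<close>, the columns by \<^typ>\<open>'n\<close>, and \<open>\<le>\<close> on vectors is the componentwise order.\<close>

definition feasible :: "real^'n^'m \<Rightarrow> real^'m \<Rightarrow> (real^'n) set" where
  "feasible A b = {x. A *v x \<le> b}"

definition pos_part :: "real^'d \<Rightarrow> real^'d" where
  "pos_part v = (\<chi> j. max 0 (v $ j))"

definition fro_norm :: "real^'n^'m \<Rightarrow> real" where
  "fro_norm G = sqrt (\<Sum>i\<in>UNIV. \<Sum>j\<in>UNIV. (G $ i $ j)\<^sup>2)"

text \<open>Square roots of the eigenvalues of \<open>G\<^sup>T G\<close>. For a matrix with more columns than rows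
  this may contain an additional \<open>0\<close>, which does not affect the largest one.\<close>

definition singular_values :: "real^'n^'m \<Rightarrow> real set" where
  "singular_values G =
     {s. s \<ge> 0 \<and> (\<exists>v. v \<noteq> 0 \<and> (transpose G ** G) *v v = s\<^sup>2 *\<^sub>R v)}"

definition sigma_max :: "real^'n^'m \<Rightarrow> real" where
  "sigma_max G = Max (singular_values G)"

text \<open>The row submatrix of \<open>A\<close> and the subvector of \<open>b\<close> indexed by \<open>J\<close> depend on a set of
  indices that is not a type, so they are represented with the original index type, the entries
  outside \<open>J\<close> being zero. The lemmas below show that the quantities formed from them are those of
  the genuine submatrix: every sum runs over \<open>J\<close> only. In particular the Gram matrix
  \<open>A\<^sub>J\<^sup>T A\<^sub>J\<close>, hence the largest singular value, is unchanged.\<close>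

definition row_block :: "real^'n^'m \<Rightarrow> 'm set \<Rightarrow> real^'n^'m" where
  "row_block A J = (\<chi> i j. if i \<in> J then A $ i $ j else 0)"

definition vec_block :: "real^'m \<Rightarrow> 'm set \<Rightarrow> real^'m" where
  "vec_block b J = (\<chi> i. if i \<in> J then b $ i else 0)"

definition block_resid :: "real^'n^'m \<Rightarrow> real^'m \<Rightarrow> 'm set \<Rightarrow> real^'n \<Rightarrow> real^'m" where
  "block_resid A b J x = pos_part (row_block A J *v x - vec_block b J)"

lemma block_resid_nth:
  "block_resid A b J x $ i = (if i \<in> J then max 0 ((A *v x) $ i - b $ i) else 0)"
  by (simp add: block_resid_def pos_part_def row_block_def vec_block_def
      matrix_vector_mult_def)

lemma norm_block_resid:
  "(norm (block_resid A b J x))\<^sup>2 = (\<Sum>i\<in>J. (max 0 ((A *v x) $ i - b $ i))\<^sup>2)"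
proof -
  have "(norm (block_resid A b J x))\<^sup>2 =
      (\<Sum>i\<in>UNIV. if i \<in> J then (max 0 ((A *v x) $ i - b $ i))\<^sup>2 else 0)"
    unfolding norm_vec_def L2_set_def
    by (subst real_sqrt_pow2) (auto intro!: sum_nonneg sum.cong simp: block_resid_nth)
  then show ?thesis by (simp add: sum.If_cases)
qed

lemma fro_norm_row_block:
  "fro_norm (row_block A J) = sqrt (\<Sum>i\<in>J. \<Sum>j\<in>UNIV. (A $ i $ j)\<^sup>2)"
proof -
  have "(\<Sum>i\<in>UNIV. \<Sum>j\<in>UNIV. (row_block A J $ i $ j)\<^sup>2) =
      (\<Sum>i\<in>UNIV. if i \<in> J then \<Sum>j\<in>UNIV. (A $ i $ j)\<^sup>2 else 0)"
    by (intro sum.cong) (auto simp: row_block_def)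
  then show ?thesis by (simp add: fro_norm_def sum.If_cases)
qed

lemma transpose_row_block_resid:
  "(transpose (row_block A J) *v block_resid A b J x) $ j =
     (\<Sum>i\<in>J. A $ i $ j * max 0 ((A *v x) $ i - b $ i))"
proof -
  have "(transpose (row_block A J) *v block_resid A b J x) $ j =
      (\<Sum>i\<in>UNIV. if i \<in> J then A $ i $ j * max 0 ((A *v x) $ i - b $ i) else 0)"
    unfolding matrix_vector_mult_def transpose_def
    by (auto intro!: sum.cong simp: block_resid_nth[unfolded matrix_vector_mult_def] row_block_def)
  then show ?thesis by (simp add: sum.If_cases)
qed

lemma gram_row_block:
  "(transpose (row_block A J) ** row_block A J) $ j $ l = (\<Sum>i\<in>J. A $ i $ j * A $ i $ l)"
proof -
  have "(transpose (row_block A J) ** row_block A J) $ j $ l =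
      (\<Sum>i\<in>UNIV. if i \<in> J then A $ i $ j * A $ i $ l else 0)"
    unfolding matrix_matrix_mult_def transpose_def
    by (auto intro!: sum.cong simp: row_block_def)
  then show ?thesis by (simp add: sum.If_cases)
qed

definition indexed_partition :: "nat \<Rightarrow> (nat \<Rightarrow> 'm set) \<Rightarrow> bool" where
  "indexed_partition t I \<longleftrightarrow>
     (\<forall>i\<in>{1..t}. I i \<noteq> {}) \<and> disjoint_family_on I {1..t} \<and> (\<Union>i\<in>{1..t}. I i) = UNIV"

definition zeta :: "real^'n^'m \<Rightarrow> nat \<Rightarrow> (nat \<Rightarrow> 'm set) \<Rightarrow> real" where
  "zeta A t I =
     Max ((\<lambda>i. (sigma_max (row_block A (I i)))\<^sup>2 / (fro_norm (row_block A (I i)))\<^sup>2) ` {1..t})"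

definition hoffman_constant :: "real^'n^'m \<Rightarrow> real^'m \<Rightarrow> real \<Rightarrow> bool" where
  "hoffman_constant A b L \<longleftrightarrow>
     L > 0 \<and>
     (\<forall>x. (norm (x - closest_point (feasible A b) x))\<^sup>2 \<le> L\<^sup>2 * (norm (pos_part (A *v x - b)))\<^sup>2)"

definition epsilon :: "real^'n^'m \<Rightarrow> real^'m \<Rightarrow> nat \<Rightarrow> (nat \<Rightarrow> 'm set) \<Rightarrow> real^'n \<Rightarrow> real" where
  "epsilon A b t I x =
     1 / 2 *
     (1 / (norm (pos_part (A *v x - b)))\<^sup>2 *
        Max ((\<lambda>i. (norm (block_resid A b (I i) x))\<^sup>2 / (fro_norm (row_block A (I i)))\<^sup>2) ` {1..t})
      + 1 / (fro_norm A)\<^sup>2)"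

definition greedy_set :: "real^'n^'m \<Rightarrow> real^'m \<Rightarrow> nat \<Rightarrow> (nat \<Rightarrow> 'm set) \<Rightarrow> real^'n \<Rightarrow> nat set" where
  "greedy_set A b t I x =
     {i\<in>{1..t}. (norm (block_resid A b (I i) x))\<^sup>2 \<ge>
        epsilon A b t I x * (norm (pos_part (A *v x - b)))\<^sup>2 * (fro_norm (row_block A (I i)))\<^sup>2}"

definition grabp_step ::
  "real^'n^'m \<Rightarrow> real^'m \<Rightarrow> 'm set \<Rightarrow> real \<Rightarrow> real^'n \<Rightarrow> real^'n" where
  "grabp_step A b J \<alpha> x =
     (if x \<in> feasible A b then x
      else x - (\<alpha> / (fro_norm (row_block A J))\<^sup>2) *\<^sub>R
                 (transpose (row_block A J) *v block_resid A b J x))"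

definition adaptive_stepsize ::
  "real \<Rightarrow> real^'n^'m \<Rightarrow> real^'m \<Rightarrow> 'm set \<Rightarrow> real^'n \<Rightarrow> real" where
  "adaptive_stepsize w A b J x =
     w * ((norm (block_resid A b J x))\<^sup>2 * (fro_norm (row_block A J))\<^sup>2 /
          (norm (transpose (row_block A J) *v block_resid A b J x))\<^sup>2)"

text \<open>The sigma-algebra of the first \<open>k\<close> iterations. It is generated by the selected indices alone,
  because the starting point is deterministic and the stepsizes considered (such as the adaptive
  one) are functions of the current iterate and the selected index.\<close>

definition past :: "'w measure \<Rightarrow> (nat \<Rightarrow> 'w \<Rightarrow> nat) \<Rightarrow> nat \<Rightarrow> 'w measure" where
  "past M sel k = sigma (space M) {{\<omega>\<in>space M. sel j \<omega> = i} | i j. j < k}"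

text \<open>\<open>sel k\<close> is the block index drawn at iteration \<open>k\<close>, \<open>p k i\<close> the probability \<open>p\<^sub>k\<^sub>,\<^sub>i\<close> (a random
  variable) and \<open>X k\<close> the iterate \<open>x\<^sup>k\<close>. As no index is drawn when the iterate is already feasible,
  nothing is required of \<open>sel k\<close> (except being a random variable) and of \<open>p k\<close> on that event.
  That \<open>p k\<close> depends only on the past follows from its almost sure equality with a conditional
  probability given the past.\<close>

definition grabp_process ::
  "'w measure \<Rightarrow> real^'n^'m \<Rightarrow> real^'m \<Rightarrow> nat \<Rightarrow> (nat \<Rightarrow> 'm set) \<Rightarrow> real^'n \<Rightarrow>
   (nat \<Rightarrow> 'w \<Rightarrow> real) \<Rightarrow> (nat \<Rightarrow> nat \<Rightarrow> 'w \<Rightarrow> real) \<Rightarrow> (nat \<Rightarrow> 'w \<Rightarrow> nat) \<Rightarrow>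
   (nat \<Rightarrow> 'w \<Rightarrow> real^'n) \<Rightarrow> bool" where
  "grabp_process M A b t I x0 \<alpha> p sel X \<longleftrightarrow>
     (\<forall>k. sel k \<in> measurable M (count_space UNIV)) \<and>
     (\<forall>\<omega>\<in>space M. X 0 \<omega> = x0 \<and>
        (\<forall>k. X (Suc k) \<omega> = grabp_step A b (I (sel k \<omega>)) (\<alpha> k \<omega>) (X k \<omega>))) \<and>
     (\<forall>k. AE \<omega> in M. X k \<omega> \<notin> feasible A b \<longrightarrow>
        (\<forall>i\<in>{1..t}.
           real_cond_exp M (past M sel k) (indicator {\<omega>\<in>space M. sel k \<omega> = i}) \<omega> = p k i \<omega> \<and>
           p k i \<omega> \<ge> 0 \<and> (i \<notin> greedy_set A b t I (X k \<omega>) \<longrightarrow> p k i \<omega> = 0)) \<and>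
        (\<Sum>i\<in>greedy_set A b t I (X k \<omega>). p k i \<omega>) = 1)"

end

theory Submission
  imports Defs
begin

text \<open>The contraction holds along almost every trajectory, not merely in expectation, because it
  only uses that the selected block is a greedy one.

  Let \<open>x\<close> be infeasible with projection \<open>z\<close> onto \<open>S\<close>, let \<open>i\<close> be a greedy block with residual
  \<open>r\<^sub>i = (A\<^sub>i x - b\<^sub>i)\<^sub>+\<close>, and put \<open>u = A\<^sub>i\<^sup>T r\<^sub>i\<close>. Since \<open>A\<^sub>i z \<le> b\<^sub>i\<close>, the half-space
  \<open>{y. u \<bullet> (x - y) \<ge> \<parallel>r\<^sub>i\<parallel>\<^sup>2}\<close> contains \<open>S\<close> (\<open>block_resid_sq_le_inner\<close>), and the adaptive stepsize
  makes the iteration a projection onto that half-space, relaxed by \<open>w\<close>. Such a step lowers the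
  squared distance to \<open>z\<close> by at least \<open>(2 w - w\<^sup>2) \<parallel>r\<^sub>i\<parallel>\<^sup>4 / \<parallel>u\<parallel>\<^sup>2\<close>
  (\<open>relaxed_projection_decrease\<close>). Three estimates turn this into a multiple of the squared distance:
  \<open>\<parallel>u\<parallel> \<le> \<sigma>\<^sub>m\<^sub>a\<^sub>x(A\<^sub>i) \<parallel>r\<^sub>i\<parallel>\<close>, which brings in \<open>\<zeta>\<close>; the greedy rule together with
  \<open>\<epsilon> \<ge> 1 / \<parallel>A\<parallel>\<^sub>F\<^sup>2\<close>, where a maximum is bounded below by a weighted average (\<open>epsilon_ge\<close>); and
  Hoffman's inequality. The outcome is \<open>grabp_step_contraction\<close>.

  Randomness enters through \<open>grabp_process_selects_greedy\<close> alone: on the event that the current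
  iterate is infeasible with greedy set \<open>V\<close>, which belongs to the past, the conditional probabilities
  of the indices in \<open>V\<close> add up to 1, so the drawn index lies in \<open>V\<close> almost surely. Iterating the
  contraction and integrating the resulting deterministic bound gives the theorem.\<close>

section \<open>The largest singular value bounds a matrix and its transpose\<close>

lemma norm_matrix_vector_sq:
  fixes G :: "real^'n^'m"
  shows "(norm (G *v v))\<^sup>2 = ((transpose G ** G) *v v) \<bullet> v"
  by (simp add: power2_norm_eq_inner dot_lmul_matrix flip: matrix_vector_mul_assoc)

text \<open>Eigenvectors of the symmetric matrix \<open>G\<^sup>T G\<close> for different eigenvalues are orthogonal, so
  choosing one for each singular value gives a linearly independent set. Finiteness is what makes
  the \<^const>\<open>Max\<close> in \<^const>\<open>sigma_max\<close> meaningful.\<close>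
lemma finite_singular_values:
  fixes G :: "real^'n^'m"
  shows "finite (singular_values G)"
proof -
  let ?H = "transpose G ** G"
  have "\<forall>s\<in>singular_values G. \<exists>v. v \<noteq> 0 \<and> ?H *v v = s\<^sup>2 *\<^sub>R v"
    by (auto simp: singular_values_def)
  then obtain e where e: "\<And>s. s \<in> singular_values G \<Longrightarrow> e s \<noteq> 0 \<and> ?H *v e s = s\<^sup>2 *\<^sub>R e s"
    by metis
  have symm: "(?H *v u) \<bullet> v = u \<bullet> (?H *v v)" for u v
    by (simp add: dot_lmul_matrix inner_commute[of u] flip: matrix_vector_mul_assoc)
       (simp add: inner_commute)
  have orth: "e s \<bullet> e s' = 0"
    if "s \<in> singular_values G" "s' \<in> singular_values G" "s \<noteq> s'" for s s'
  proof -
    have "s\<^sup>2 * (e s \<bullet> e s') = s'\<^sup>2 * (e s \<bullet> e s')"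
      using symm[of "e s" "e s'"] e that by simp
    moreover have "s\<^sup>2 \<noteq> s'\<^sup>2"
      using that by (auto simp: singular_values_def power2_eq_iff_nonneg)
    ultimately show ?thesis by auto
  qed
  have inj: "inj_on e (singular_values G)"
    by (rule inj_onI) (metis e orth inner_eq_zero_iff)
  have "pairwise orthogonal (e ` singular_values G)"
    by (auto simp: pairwise_def orthogonal_def intro!: orth)
  then have "independent (e ` singular_values G)"
    using e by (intro pairwise_orthogonal_independent) force+
  then have "finite (e ` singular_values G)"
    using independent_bound by blast
  then show ?thesis
    using inj by (rule finite_imageD)
qed

text \<open>By compactness \<open>\<parallel>G v\<parallel>\<close> has a maximum \<open>s\<close> on the unit sphere, attained at some \<open>v\<^sub>0\<close>. The
  quadratic form \<open>B v = s\<^sup>2 \<parallel>v\<parallel>\<^sup>2 - \<parallel>G v\<parallel>\<^sup>2\<close> is nonnegative and vanishes at \<open>v\<^sub>0\<close>, hence its gradient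
  vanishes there, which says that \<open>v\<^sub>0\<close> is an eigenvector of \<open>G\<^sup>T G\<close> for \<open>s\<^sup>2\<close>. So \<open>s\<close> is itself a
  singular value.\<close>
lemma norm_mult_le_sigma_max:
  fixes G :: "real^'n^'m"
  shows "norm (G *v v) \<le> sigma_max G * norm v"
    and sigma_max_nonneg: "0 \<le> sigma_max G"
proof -
  let ?H = "transpose G ** G"
  have "continuous_on (sphere 0 1) (\<lambda>v. norm (G *v v))"
    by (intro continuous_intros linear_continuous_on) (simp add: matrix_vector_mul_bounded_linear)
  then obtain v0 where v0: "norm v0 = 1"
    and max: "\<And>v. norm v = 1 \<Longrightarrow> norm (G *v v) \<le> norm (G *v v0)"
    using continuous_attains_sup[of "sphere (0::real^'n) 1" "\<lambda>v. norm (G *v v)"] by auto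
  define s where "s = norm (G *v v0)"
  have bound: "norm (G *v v) \<le> s * norm v" for v
  proof (cases "v = 0")
    case False
    have "norm (G *v ((1 / norm v) *\<^sub>R v)) \<le> s"
      unfolding s_def by (rule max) (use False in simp)
    then show ?thesis
      using False by (simp add: matrix_vector_mult_scaleR field_simps)
  qed simp
  define B where "B v = s\<^sup>2 * (v \<bullet> v) - (?H *v v) \<bullet> v" for v
  have B_nonneg: "0 \<le> B v" for v
    using power_mono[OF bound[of v], of 2] norm_matrix_vector_sq[of G v]
    by (simp add: B_def power_mult_distrib power2_norm_eq_inner)
  have symm: "(?H *v u) \<bullet> v = (?H *v v) \<bullet> u" for u v
    by (simp add: dot_lmul_matrix inner_commute[of "G *v u"] flip: matrix_vector_mul_assoc)
  have B_v0: "B v0 = 0"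
    using v0 norm_matrix_vector_sq[of G v0] by (simp add: B_def s_def flip: power2_norm_eq_inner)
  \<comment> \<open>Half the gradient of \<open>B\<close> at \<open>v\<^sub>0\<close>.\<close>
  define g where "g = s\<^sup>2 *\<^sub>R v0 - ?H *v v0"
  have expand: "B (v0 + \<tau> *\<^sub>R g) = 2 * \<tau> * (g \<bullet> g) + \<tau>\<^sup>2 * B g" for \<tau>
  proof -
    have "B (v0 + \<tau> *\<^sub>R g) = B v0 + 2 * \<tau> * (s\<^sup>2 * (v0 \<bullet> g) - (?H *v v0) \<bullet> g) + \<tau>\<^sup>2 * B g"
      using symm[of g v0]
      by (simp add: B_def matrix_vector_right_distrib matrix_vector_mult_scaleR inner_add_left
          inner_add_right inner_commute power2_eq_square algebra_simps)
    also have "s\<^sup>2 * (v0 \<bullet> g) - (?H *v v0) \<bullet> g = g \<bullet> g"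
      by (subst (3) g_def) (simp add: inner_diff_left)
    finally show ?thesis using B_v0 by simp
  qed
  have "g \<bullet> g = 0"
  proof (rule ccontr)
    assume "g \<bullet> g \<noteq> 0"
    then have pos: "g \<bullet> g > 0" by (metis inner_gt_zero_iff inner_eq_zero_iff)
    \<comment> \<open>A small step from \<open>v\<^sub>0\<close> against the gradient would make \<open>B\<close> negative. The 1 in the
      denominator covers the case \<open>B g = 0\<close>.\<close>
    define \<tau> where "\<tau> = g \<bullet> g / (B g + 1)"
    have \<tau>: "\<tau> > 0" "\<tau> * B g \<le> g \<bullet> g"
      using pos B_nonneg[of g] by (auto simp: \<tau>_def field_simps)
    have "0 \<le> \<tau> * (\<tau> * B g) - 2 * \<tau> * (g \<bullet> g)"
      using B_nonneg[of "v0 + (- \<tau>) *\<^sub>R g"] expand[of "- \<tau>"]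
      by (simp add: power2_eq_square mult.assoc)
    also have "\<dots> \<le> \<tau> * (g \<bullet> g) - 2 * \<tau> * (g \<bullet> g)"
      using mult_left_mono[OF \<tau>(2), of \<tau>] \<tau>(1) by simp
    also have "\<dots> < 0"
      using \<tau>(1) pos by simp
    finally show False by simp
  qed
  then have "?H *v v0 = s\<^sup>2 *\<^sub>R v0" by (simp add: g_def)
  moreover have "v0 \<noteq> 0" using v0 by auto
  ultimately have "s \<in> singular_values G"
    by (auto simp: singular_values_def s_def)
  then have "s \<le> sigma_max G"
    unfolding sigma_max_def by (intro Max_ge finite_singular_values)
  then show "norm (G *v v) \<le> sigma_max G * norm v"
    by (meson bound mult_right_mono norm_ge_zero order_trans)
  show "0 \<le> sigma_max G"
    using \<open>s \<le> sigma_max G\<close> by (simp add: s_def) (meson norm_ge_zero order_trans)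
qed

lemma norm_transpose_mult_le_sigma_max:
  fixes G :: "real^'n^'m"
  shows "norm (transpose G *v y) \<le> sigma_max G * norm y"
proof (cases "transpose G *v y = 0")
  case True
  then show ?thesis by (simp add: sigma_max_nonneg)
next
  case False
  let ?u = "transpose G *v y"
  have "norm ?u * norm ?u = y \<bullet> (G *v ?u)"
    by (simp add: dot_lmul_matrix[symmetric] power2_norm_eq_inner flip: power2_eq_square)
  also have "\<dots> \<le> norm y * norm (G *v ?u)"
    by (rule norm_cauchy_schwarz)
  also have "\<dots> \<le> norm y * (sigma_max G * norm ?u)"
    by (intro mult_left_mono norm_mult_le_sigma_max) simp
  finally show ?thesis using False by (simp add: mult.commute mult.left_commute)
qed

section \<open>One step as a relaxed projection onto a half-space\<close>

lemma norm_pos_part_sq_le_inner: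
  assumes "y \<le> 0"
  shows "(norm (pos_part v))\<^sup>2 \<le> pos_part v \<bullet> (v - y)"
  unfolding power2_norm_eq_inner inner_vec_def
proof (rule sum_mono)
  fix j
  have "y $ j \<le> 0" using assms by (simp add: less_eq_vec_def)
  then show "pos_part v $ j \<bullet> pos_part v $ j \<le> pos_part v $ j \<bullet> (v - y) $ j"
    by (auto simp: pos_part_def max_def mult_left_mono)
qed

text \<open>For a feasible \<open>z\<close> the vector \<open>A\<^sub>J z - b\<^sub>J\<close> is nonpositive, and \<open>A\<^sub>J x - b\<^sub>J\<close> agrees with the
  residual wherever the latter is nonzero. Geometrically, all of \<open>S\<close> lies behind the hyperplane on
  which the unrelaxed step lands.\<close>
lemma block_resid_sq_le_inner:
  assumes "z \<in> feasible A b"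
  shows "(norm (block_resid A b J x))\<^sup>2
    \<le> (transpose (row_block A J) *v block_resid A b J x) \<bullet> (x - z)"
proof -
  let ?G = "row_block A J" and ?c = "vec_block b J"
  have "?G *v z - ?c \<le> 0"
    using assms
    by (auto simp: feasible_def less_eq_vec_def row_block_def vec_block_def matrix_vector_mult_def)
  from norm_pos_part_sq_le_inner[OF this, of "?G *v x - ?c"] show ?thesis
    by (simp add: block_resid_def dot_lmul_matrix matrix_vector_mult_diff_distrib)
qed

text \<open>The point \<open>x - (s / \<parallel>u\<parallel>\<^sup>2) u\<close> is the projection of \<open>x\<close> onto the hyperplane
  \<open>{y. u \<bullet> (x - y) = s}\<close>, and \<open>z\<close> lies behind that hyperplane. Relaxing by \<open>w\<close> contributes
  \<open>- 2 w\<close> through the linear term and \<open>w\<^sup>2\<close> through the quadratic one. If \<open>u = 0\<close>, both quotients are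
  0 by the convention for division.\<close>
lemma relaxed_projection_decrease:
  fixes x z u :: "'a::real_inner"
  assumes "0 \<le> s" "s \<le> u \<bullet> (x - z)" "0 \<le> w"
  shows "(norm (x - (w * s / (norm u)\<^sup>2) *\<^sub>R u - z))\<^sup>2
    \<le> (norm (x - z))\<^sup>2 - (2 * w - w\<^sup>2) * (s\<^sup>2 / (norm u)\<^sup>2)"
proof (cases "u = 0")
  case False
  define n where "n = (norm u)\<^sup>2"
  have n: "n > 0" "u \<bullet> u = n" using False by (auto simp: n_def power2_norm_eq_inner)
  define c where "c = w * s / n"
  have "(norm (x - c *\<^sub>R u - z))\<^sup>2 = (norm (x - z))\<^sup>2 - 2 * c * (u \<bullet> (x - z)) + c\<^sup>2 * n"
    unfolding power2_norm_eq_inner n(2)[symmetric]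
    by (simp add: inner_diff_left inner_diff_right inner_commute power2_eq_square algebra_simps)
  also have "\<dots> \<le> (norm (x - z))\<^sup>2 - 2 * c * s + c\<^sup>2 * n"
    using mult_left_mono[OF assms(2), of c] assms n by (simp add: c_def)
  also have "\<dots> = (norm (x - z))\<^sup>2 - (2 * w - w\<^sup>2) * (s\<^sup>2 / n)"
    using n by (simp add: c_def power2_eq_square field_simps)
  finally show ?thesis by (simp add: c_def n_def)
qed simp

section \<open>The greedy threshold\<close>

lemma fro_norm_sq: "(fro_norm A)\<^sup>2 = (\<Sum>i\<in>UNIV. \<Sum>j\<in>UNIV. (A $ i $ j)\<^sup>2)"
  by (simp add: fro_norm_def sum_nonneg)

lemma fro_norm_row_block_sq:
  "(fro_norm (row_block A J))\<^sup>2 = (\<Sum>i\<in>J. \<Sum>j\<in>UNIV. (A $ i $ j)\<^sup>2)"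
  by (simp add: fro_norm_row_block sum_nonneg)

lemma fro_norm_row_block_pos:
  fixes A :: "real^'n^'m"
  assumes "\<forall>i. row i A \<noteq> 0" "J \<noteq> {}"
  shows "0 < (fro_norm (row_block A J))\<^sup>2"
  unfolding fro_norm_row_block_sq
proof (rule sum_pos)
  fix i
  obtain l where "A $ i $ l \<noteq> 0"
    using assms(1) by (metis row_def vec_lambda_eta vec_eq_iff zero_index)
  then show "0 < (\<Sum>j\<in>UNIV. (A $ i $ j)\<^sup>2)"
    by (intro sum_pos2[of _ l]) auto
qed (use assms in auto)

lemma fro_norm_pos:
  fixes A :: "real^'n^'m"
  assumes "\<forall>i. row i A \<noteq> 0"
  shows "0 < (fro_norm A)\<^sup>2"
  using fro_norm_row_block_pos[OF assms, of UNIV]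
  unfolding fro_norm_row_block_sq by (simp only: fro_norm_sq UNIV_not_empty not_False_eq_True simp_thms)

lemma sum_indexed_partition:
  fixes f :: "'m::finite \<Rightarrow> real"
  assumes "indexed_partition t I"
  shows "sum f UNIV = (\<Sum>i\<in>{1..t}. sum f (I i))"
proof -
  have "sum f (\<Union>i\<in>{1..t}. I i) = (\<Sum>i\<in>{1..t}. sum f (I i))"
    using assms by (intro sum.UNION_disjoint)
      (auto simp: indexed_partition_def disjoint_family_on_def)
  then show ?thesis using assms by (simp add: indexed_partition_def)
qed

lemma norm_pos_part_sq:
  "(norm (pos_part (A *v x - b)))\<^sup>2 = (\<Sum>i\<in>UNIV. (max 0 ((A *v x) $ i - b $ i))\<^sup>2)"
  unfolding power2_norm_eq_inner inner_vec_def
  by (simp add: pos_part_def power2_eq_square)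

lemma norm_pos_part_pos:
  assumes "x \<notin> feasible A b"
  shows "0 < (norm (pos_part (A *v x - b)))\<^sup>2"
proof -
  obtain i where "(A *v x) $ i > b $ i"
    using assms by (auto simp: feasible_def less_eq_vec_def not_le)
  then show ?thesis
    unfolding norm_pos_part_sq by (intro sum_pos2[of _ i]) auto
qed

text \<open>The squared residual norm and the squared Frobenius norm are both additive over the blocks, so
  \<open>\<parallel>r\<parallel>\<^sup>2 / \<parallel>A\<parallel>\<^sub>F\<^sup>2\<close> is an average of the blockwise quotients with weights
  \<open>\<parallel>A\<^sub>i\<parallel>\<^sub>F\<^sup>2 / \<parallel>A\<parallel>\<^sub>F\<^sup>2\<close>. The largest quotient is at least that average, which makes both summands in
  \<^const>\<open>epsilon\<close> at least \<open>1 / (2 \<parallel>A\<parallel>\<^sub>F\<^sup>2)\<close>.\<close>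
lemma epsilon_ge:
  fixes A :: "real^'n^'m"
  assumes "\<forall>i. row i A \<noteq> 0" "indexed_partition t I" "x \<notin> feasible A b"
  shows "1 / (fro_norm A)\<^sup>2 \<le> epsilon A b t I x"
proof -
  let ?r = "\<lambda>i. (norm (block_resid A b (I i) x))\<^sup>2"
  let ?f = "\<lambda>i. (fro_norm (row_block A (I i)))\<^sup>2"
  let ?R = "(norm (pos_part (A *v x - b)))\<^sup>2" and ?F = "(fro_norm A)\<^sup>2"
  define m where "m = Max ((\<lambda>i. ?r i / ?f i) ` {1..t})"
  have le: "?r i \<le> m * ?f i" if "i \<in> {1..t}" for i
  proof -
    have "?r i / ?f i \<le> m" unfolding m_def using that by (intro Max_ge) auto
    moreover have "?f i > 0"
      using assms that by (intro fro_norm_row_block_pos) (auto simp: indexed_partition_def)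
    ultimately show ?thesis by (simp add: field_simps)
  qed
  have F: "?F = (\<Sum>i\<in>{1..t}. ?f i)"
    unfolding fro_norm_row_block_sq unfolding fro_norm_sq by (rule sum_indexed_partition[OF assms(2)])
  have "?R = (\<Sum>i\<in>{1..t}. ?r i)"
    unfolding norm_pos_part_sq norm_block_resid by (rule sum_indexed_partition[OF assms(2)])
  also have "\<dots> \<le> (\<Sum>i\<in>{1..t}. m * ?f i)" by (intro sum_mono le)
  also have "\<dots> = m * ?F" by (simp add: F sum_distrib_left)
  finally have "?R \<le> m * ?F" .
  moreover have "?F > 0" by (rule fro_norm_pos[OF assms(1)])
  moreover have "?R > 0" by (rule norm_pos_part_pos[OF assms(3)])
  ultimately have "1 / ?F \<le> 1 / ?R * m" by (simp add: field_simps)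
  then show ?thesis by (simp add: epsilon_def m_def)
qed

section \<open>Contraction along a greedy trajectory\<close>

text \<open>With \<open>s = \<parallel>r\<^sub>i\<parallel>\<^sup>2\<close>, \<open>R = \<parallel>r\<parallel>\<^sup>2\<close>, \<open>f = \<parallel>A\<^sub>i\<parallel>\<^sub>F\<^sup>2\<close>, \<open>F = \<parallel>A\<parallel>\<^sub>F\<^sup>2\<close> and \<open>Z = \<zeta>\<close>, the relaxed projection
  gains \<open>s\<^sup>2 / \<parallel>u\<parallel>\<^sup>2 \<ge> s / (Z f) \<ge> R / (Z F) \<ge> d x / (Z L\<^sup>2 F)\<close>, up to the factor \<open>2 w - w\<^sup>2\<close>. The
  old projection \<open>z\<close> remains a feasible competitor for the distance of the new iterate.\<close>
lemma grabp_step_contraction: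
  fixes A :: "real^'n^'m" and b :: "real^'m"
  defines "d \<equiv> \<lambda>x. (norm (x - closest_point (feasible A b) x))\<^sup>2"
  assumes rows: "\<forall>i. row i A \<noteq> 0" and ne: "feasible A b \<noteq> {}"
    and part: "indexed_partition t I" and hoff: "hoffman_constant A b L"
    and w: "0 < w" "w < 2"
    and sel: "x \<notin> feasible A b \<Longrightarrow> i \<in> greedy_set A b t I x"
  shows "d (grabp_step A b (I i) (adaptive_stepsize w A b (I i) x) x)
    \<le> (1 - (2 * w - w\<^sup>2) / (zeta A t I * L\<^sup>2 * (fro_norm A)\<^sup>2)) * d x"
proof (cases "x \<in> feasible A b")
  case True
  then show ?thesis by (simp add: d_def grabp_step_def closest_point_self)
next
  case False
  have closed: "closed (feasible A b)"
  proof -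
    have "feasible A b = (\<lambda>x. A *v x) -` {..b}" by (auto simp: feasible_def)
    then show ?thesis
      by (simp add: closed_vimage matrix_vector_mult_linear_continuous_on)
  qed
  let ?x' = "grabp_step A b (I i) (adaptive_stepsize w A b (I i) x) x"
  define z where "z = closest_point (feasible A b) x"
  have z: "z \<in> feasible A b" unfolding z_def by (rule closest_point_in_set[OF closed ne])
  define u where "u = transpose (row_block A (I i)) *v block_resid A b (I i) x"
  define s where "s = (norm (block_resid A b (I i) x))\<^sup>2"
  define f where "f = (fro_norm (row_block A (I i)))\<^sup>2"
  define F where "F = (fro_norm A)\<^sup>2"
  define R where "R = (norm (pos_part (A *v x - b)))\<^sup>2"
  define Z where "Z = zeta A t I"
  have greedy: "i \<in> {1..t}" "s \<ge> epsilon A b t I x * R * f"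
    using sel[OF False] by (auto simp: greedy_set_def s_def R_def f_def)
  have f: "f > 0"
    unfolding f_def using greedy(1) part
    by (intro fro_norm_row_block_pos rows) (auto simp: indexed_partition_def)
  have F: "F > 0"
    unfolding F_def by (rule fro_norm_pos[OF rows])
  have R: "R > 0" unfolding R_def by (rule norm_pos_part_pos[OF False])
  have s_ge: "s \<ge> R * f / F"
  proof -
    have "R * f / F = 1 / F * (R * f)" by simp
    also have "\<dots> \<le> epsilon A b t I x * (R * f)"
      using epsilon_ge[OF rows part False] R f by (intro mult_right_mono) (auto simp: F_def)
    finally show ?thesis using greedy(2) by (simp add: mult.assoc)
  qed
  have s: "s > 0" using s_ge R f F by (meson divide_pos_pos less_le_trans mult_pos_pos)
  have s_inner: "s \<le> u \<bullet> (x - z)"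
    unfolding s_def u_def by (rule block_resid_sq_le_inner[OF z])
  have u: "(norm u)\<^sup>2 > 0" using s s_inner by auto
  have u_le: "(norm u)\<^sup>2 \<le> Z * f * s"
  proof -
    have "(sigma_max (row_block A (I i)))\<^sup>2 / f \<le> Z"
      unfolding Z_def zeta_def f_def using greedy(1) by (intro Max_ge) auto
    then have "(sigma_max (row_block A (I i)))\<^sup>2 \<le> Z * f"
      using f by (simp add: field_simps)
    moreover have "(norm u)\<^sup>2 \<le> (sigma_max (row_block A (I i)))\<^sup>2 * s"
      using power_mono[OF norm_transpose_mult_le_sigma_max
          [of "row_block A (I i)" "block_resid A b (I i) x"], of 2]
      by (simp add: u_def s_def power_mult_distrib)
    ultimately show ?thesis using s by (meson less_imp_le mult_right_mono order_trans)
  qed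
  \<comment> \<open>The greedy rule forces \<open>s > 0\<close>, hence \<open>u \<noteq> 0\<close>, and this excludes \<open>\<zeta> = 0\<close>.\<close>
  have Z: "Z > 0"
  proof -
    have "0 < Z * (f * s)" using less_le_trans[OF u u_le] by (simp only: mult.assoc)
    then show ?thesis by (rule zero_less_mult_pos2) (use f s in simp)
  qed
  have L: "L > 0" "d x \<le> L\<^sup>2 * R"
    using hoff by (auto simp: hoffman_constant_def d_def R_def)
  have "d x / (Z * L\<^sup>2 * F) \<le> L\<^sup>2 * R / (Z * L\<^sup>2 * F)"
    using L Z F by (intro divide_right_mono) auto
  also have "\<dots> = (R * f / F) / (Z * f)"
    using L Z F f by (simp add: field_simps)
  also have "\<dots> \<le> s / (Z * f)"
    using s_ge Z f by (intro divide_right_mono) auto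
  also have "\<dots> = s\<^sup>2 / (Z * f * s)"
    using s by (simp add: power2_eq_square)
  also have "\<dots> \<le> s\<^sup>2 / (norm u)\<^sup>2"
    using u u_le Z f s by (intro divide_left_mono mult_pos_pos) auto
  finally have key: "d x / (Z * L\<^sup>2 * F) \<le> s\<^sup>2 / (norm u)\<^sup>2" .
  have step: "?x' = x - (w * s / (norm u)\<^sup>2) *\<^sub>R u"
    using False f by (simp add: grabp_step_def adaptive_stepsize_def u_def s_def f_def)
  have "0 < (2 - w) * w" using w by simp
  then have ww: "0 < 2 * w - w\<^sup>2" by (simp add: power2_eq_square algebra_simps)
  have "d ?x' \<le> (norm (?x' - z))\<^sup>2"
    using closest_point_le[OF closed z, of ?x'] by (auto simp: d_def dist_norm intro!: power_mono)
  also have "\<dots> \<le> (norm (x - z))\<^sup>2 - (2 * w - w\<^sup>2) * (s\<^sup>2 / (norm u)\<^sup>2)"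
    unfolding step using s s_inner w by (intro relaxed_projection_decrease) auto
  also have "\<dots> \<le> (norm (x - z))\<^sup>2 - (2 * w - w\<^sup>2) * (d x / (Z * L\<^sup>2 * F))"
    using ww key by (intro diff_left_mono mult_left_mono) auto
  also have "\<dots> = (1 - (2 * w - w\<^sup>2) / (Z * L\<^sup>2 * F)) * d x"
    by (simp add: d_def z_def algebra_simps)
  finally show ?thesis by (simp add: Z_def F_def)
qed

section \<open>The selected block is almost surely greedy\<close>

lemma space_past [simp]: "space (past M sel k) = space M"
  by (auto simp: past_def intro!: space_measure_of)

lemma sets_past:
  "sets (past M sel k) = sigma_sets (space M) {{\<omega>\<in>space M. sel j \<omega> = i} | i j. j < k}"
  by (auto simp: past_def intro!: sets_measure_of)

lemma sets_past_mono: "j \<le> k \<Longrightarrow> sets (past M sel j) \<subseteq> sets (past M sel k)"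
  unfolding sets_past by (rule sigma_sets_mono') force

lemma subalgebra_past:
  assumes "\<And>j. sel j \<in> measurable M (count_space UNIV)"
  shows "subalgebra M (past M sel k)"
  unfolding subalgebra_def sets_past
proof (intro conjI sets.sigma_sets_subset)
  show "{{\<omega>\<in>space M. sel j \<omega> = i} | i j. j < k} \<subseteq> sets M"
    using assms by auto
qed simp

text \<open>An iterate is a function of finitely many indices from a countable set, so each of its events is
  a countable union of events that fix these indices. This holds for an arbitrary set \<open>B\<close>.\<close>
lemma iterate_event_in_past:
  assumes "\<And>\<omega>. \<omega> \<in> space M \<Longrightarrow> X 0 \<omega> = x0"
    and "\<And>k \<omega>. \<omega> \<in> space M \<Longrightarrow> X (Suc k) \<omega> = g (sel k \<omega>) (X k \<omega>)"
  shows "{\<omega>\<in>space M. X k \<omega> \<in> B} \<in> sets (past M sel k)"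
proof (induction k arbitrary: B)
  case 0
  have "{\<omega>\<in>space M. X 0 \<omega> \<in> B} = (if x0 \<in> B then space (past M sel 0) else {})"
    using assms(1) by auto
  then show ?case by (metis sets.empty_sets sets.top)
next
  case (Suc k)
  let ?P = "sets (past M sel (Suc k))"
  have "{\<omega>\<in>space M. X k \<omega> \<in> C} \<in> ?P" for C
    using Suc[of C] sets_past_mono[of k "Suc k" M sel] by auto
  moreover have "{\<omega>\<in>space M. sel k \<omega> = i} \<in> ?P" for i
    unfolding sets_past by (rule sigma_sets.Basic) auto
  ultimately have *: "{\<omega>\<in>space M. sel k \<omega> = i} \<inter> {\<omega>\<in>space M. X k \<omega> \<in> g i -` B} \<in> ?P" for i
    by (intro sets.Int)
  have "(\<Union>i. {\<omega>\<in>space M. sel k \<omega> = i} \<inter> {\<omega>\<in>space M. X k \<omega> \<in> g i -` B}) \<in> ?P"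
    by (intro sets.countable_UN image_subsetI *)
  also have "(\<Union>i. {\<omega>\<in>space M. sel k \<omega> = i} \<inter> {\<omega>\<in>space M. X k \<omega> \<in> g i -` B})
      = {\<omega>\<in>space M. X (Suc k) \<omega> \<in> B}"
    using assms(2) by auto
  finally show ?case .
qed

text \<open>Integrating the conditional probabilities over \<open>E\<close> shows that \<open>E \<inter> {s \<in> V}\<close> has the same
  probability as \<open>E\<close>.\<close>
lemma (in prob_space) AE_mem_if_cond_prob_sum_1:
  fixes s :: "'a \<Rightarrow> nat"
  assumes sub: "subalgebra M N" and s: "s \<in> measurable M (count_space UNIV)"
    and E: "E \<in> sets N" and V: "finite V"
    and sum1: "AE \<omega> in M. \<omega> \<in> E \<longrightarrow>
      (\<Sum>i\<in>V. real_cond_exp M N (indicator {\<omega>\<in>space M. s \<omega> = i}) \<omega>) = 1"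
  shows "AE \<omega> in M. \<omega> \<in> E \<longrightarrow> s \<omega> \<in> V"
proof -
  interpret N: finite_measure_subalgebra M N
    by unfold_locales (rule sub)
  have EM: "E \<in> events" using E sub by (auto simp: subalgebra_def)
  let ?S = "\<lambda>i. {\<omega>\<in>space M. s \<omega> = i}"
  have SM: "?S i \<in> events" for i using s by auto
  let ?c = "\<lambda>i. real_cond_exp M N (indicator (?S i))"
  have int: "integrable M (indicator (?S i) :: _ \<Rightarrow> real)" for i
    using SM[of i] by (auto simp: less_top[symmetric])
  have intc: "integrable M (\<lambda>\<omega>. indicator E \<omega> * ?c i \<omega>)" for i
    using integrable_mult_indicator[OF EM N.real_cond_exp_int(1)[OF int[of i]]] by simp
  have "prob (E \<inter> ?S i) = (\<integral>\<omega>. indicator E \<omega> * ?c i \<omega> \<partial>M)" for i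
  proof -
    have intc: "integrable M (\<lambda>\<omega>. indicator E \<omega> * ?c i \<omega>)" for i
    using integrable_mult_indicator[OF EM N.real_cond_exp_int(1)[OF int[of i]]] by simp
  have "prob (E \<inter> ?S i) = (\<integral>\<omega>. indicator (E \<inter> ?S i) \<omega> \<partial>M)"
      using EM SM by simp
    also have "\<dots> = (\<integral>\<omega>\<in>E. indicator (?S i) \<omega> \<partial>M)"
      by (simp add: set_lebesgue_integral_def indicator_inter_arith)
    also have "\<dots> = (\<integral>\<omega>\<in>E. ?c i \<omega> \<partial>M)"
      by (rule N.real_cond_exp_intA[OF int E])
    finally show ?thesis by (simp add: set_lebesgue_integral_def)
  qed
  then have "(\<Sum>i\<in>V. prob (E \<inter> ?S i)) = (\<Sum>i\<in>V. \<integral>\<omega>. indicator E \<omega> * ?c i \<omega> \<partial>M)"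
    by simp
  also have "\<dots> = (\<integral>\<omega>. (\<Sum>i\<in>V. indicator E \<omega> * ?c i \<omega>) \<partial>M)"
    by (intro Bochner_Integration.integral_sum[symmetric] intc)
  also have "\<dots> = (\<integral>\<omega>. indicator E \<omega> \<partial>M)"
    using sum1 EM
    by (intro integral_cong_AE borel_measurable_sum borel_measurable_times
        borel_measurable_indicator borel_measurable_cond_exp2)
       (auto simp: indicator_def simp flip: sum_distrib_left)
  also have "\<dots> = prob E" using EM by simp
  finally have "(\<Sum>i\<in>V. prob (E \<inter> ?S i)) = prob E" .
  moreover have "prob (\<Union>i\<in>V. E \<inter> ?S i) = (\<Sum>i\<in>V. prob (E \<inter> ?S i))"
    using EM SM V by (intro finite_measure_finite_Union) (auto simp: disjoint_family_on_def)
  ultimately have eq: "prob (\<Union>i\<in>V. E \<inter> ?S i) = prob E" by simp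
  have U: "(\<Union>i\<in>V. E \<inter> ?S i) \<in> events" using EM SM V by auto
  have "prob (E - (\<Union>i\<in>V. E \<inter> ?S i)) = 0"
    using finite_measure_Diff[OF EM U] eq by auto
  then have "AE \<omega> in M. \<omega> \<notin> E - (\<Union>i\<in>V. E \<inter> ?S i)"
    using prob_eq_0 EM U by blast
  then show ?thesis
    using AE_space by eventually_elim auto
qed

lemma grabp_iterate_event_in_past:
  assumes "grabp_process M A b t I x0
           (\<lambda>k \<omega>. adaptive_stepsize w A b (I (sel k \<omega>)) (X k \<omega>)) p sel X"
  shows "{\<omega>\<in>space M. X k \<omega> \<in> B} \<in> sets (past M sel k)"
  by (rule iterate_event_in_past[where g = "\<lambda>i x. grabp_step A b (I i) (adaptive_stepsize w A b (I i) x) x"])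
     (use assms in \<open>auto simp: grabp_process_def\<close>)

text \<open>The greedy set is itself random, but it has only finitely many possible values \<open>V\<close>, and the
  events \<open>E V\<close> that separate them belong to the past.\<close>
lemma grabp_process_selects_greedy:
  assumes "prob_space M"
    and proc: "grabp_process M A b t I x0
           (\<lambda>k \<omega>. adaptive_stepsize w A b (I (sel k \<omega>)) (X k \<omega>)) p sel X"
  shows "AE \<omega> in M. X k \<omega> \<notin> feasible A b \<longrightarrow> sel k \<omega> \<in> greedy_set A b t I (X k \<omega>)"
proof -
  interpret prob_space M by fact
  have sel: "\<And>k. sel k \<in> measurable M (count_space UNIV)"
    and cond: "AE \<omega> in M. X k \<omega> \<notin> feasible A b \<longrightarrow>
        (\<forall>i\<in>{1..t}.
           real_cond_exp M (past M sel k) (indicator {\<omega>\<in>space M. sel k \<omega> = i}) \<omega> = p k i \<omega> \<and>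
           p k i \<omega> \<ge> 0 \<and> (i \<notin> greedy_set A b t I (X k \<omega>) \<longrightarrow> p k i \<omega> = 0)) \<and>
        (\<Sum>i\<in>greedy_set A b t I (X k \<omega>). p k i \<omega>) = 1"
    using proc unfolding grabp_process_def by blast+
  let ?U = "\<lambda>\<omega>. greedy_set A b t I (X k \<omega>)"
  define E where "E V = {\<omega>\<in>space M. X k \<omega> \<in> {x. x \<notin> feasible A b \<and> greedy_set A b t I x = V}}"
    for V
  have "AE \<omega> in M. \<omega> \<in> E V \<longrightarrow> sel k \<omega> \<in> V" if "V \<in> Pow {1..t}" for V
  proof (rule AE_mem_if_cond_prob_sum_1[OF subalgebra_past[where k = k, OF sel]])
    show "E V \<in> sets (past M sel k)"
      unfolding E_def by (rule grabp_iterate_event_in_past[OF proc])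
    show "finite V" using that finite_subset by auto
    show "AE \<omega> in M. \<omega> \<in> E V \<longrightarrow> (\<Sum>i\<in>V. real_cond_exp M (past M sel k)
        (indicator {\<omega>\<in>space M. sel k \<omega> = i}) \<omega>) = 1"
      using cond
    proof eventually_elim
      case (elim \<omega>)
      show ?case
      proof
        assume "\<omega> \<in> E V"
        then have "X k \<omega> \<notin> feasible A b" "?U \<omega> = V" by (auto simp: E_def)
        with elim have 1: "\<forall>i\<in>{1..t}. real_cond_exp M (past M sel k)
            (indicator {\<omega>\<in>space M. sel k \<omega> = i}) \<omega> = p k i \<omega>" and 2: "(\<Sum>i\<in>V. p k i \<omega>) = 1"
          by auto
        from 2 show "(\<Sum>i\<in>V. real_cond_exp M (past M sel k)
            (indicator {\<omega>\<in>space M. sel k \<omega> = i}) \<omega>) = 1"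
          using 1 that by (subst sum.cong[OF refl, of _ _ "\<lambda>i. p k i \<omega>"]) auto
      qed
    qed
  qed (rule sel)
  then have "AE \<omega> in M. \<forall>V\<in>Pow {1..t}. \<omega> \<in> E V \<longrightarrow> sel k \<omega> \<in> V"
    by (intro AE_finite_allI) auto
  then show ?thesis
    using AE_space
  proof eventually_elim
    case (elim \<omega>)
    have "?U \<omega> \<in> Pow {1..t}" by (auto simp: greedy_set_def)
    then show ?case using elim by (auto simp: E_def)
  qed
qed

section \<open>The convergence rate\<close>

text \<open>The usual induction needs \<open>\<rho> \<ge> 0\<close>. A negative \<open>\<rho>\<close> is harmless, since a nonnegative sequence
  can then satisfy the recursion only by vanishing identically.\<close>
lemma geometric_decay:
  fixes d :: "nat \<Rightarrow> real"
  assumes nonneg: "\<And>j. 0 \<le> d j" and step: "\<And>j. d (Suc j) \<le> \<rho> * d j"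
  shows "d k \<le> \<rho> ^ k * d 0"
proof (cases "0 \<le> \<rho>")
  case True
  show ?thesis
  proof (induction k)
    case (Suc k)
    have "d (Suc k) \<le> \<rho> * (\<rho> ^ k * d 0)"
      using step[of k] mult_left_mono[OF Suc True] by linarith
    then show ?case by (simp add: mult.assoc)
  qed simp
next
  case False
  have "d j = 0" for j
  proof -
    have "0 \<le> \<rho> * d j" using nonneg[of "Suc j"] step[of j] by linarith
    then show ?thesis using False nonneg[of j] by (auto simp: zero_le_mult_iff)
  qed
  then show ?thesis by simp
qed

theorem theorem3p3:
  fixes A :: "real^'n^'m" and b :: "real^'m"
    and t :: nat and I :: "nat \<Rightarrow> 'm set"
    and L w :: real and x0 :: "real^'n"
    and M :: "'w measure"
    and p :: "nat \<Rightarrow> nat \<Rightarrow> 'w \<Rightarrow> real"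
    and sel :: "nat \<Rightarrow> 'w \<Rightarrow> nat"
    and X :: "nat \<Rightarrow> 'w \<Rightarrow> real^'n"
    and k :: nat
  assumes "\<forall>i. row i A \<noteq> 0"
    and "feasible A b \<noteq> {}"
    and "indexed_partition t I"
    and "hoffman_constant A b L"
    and "0 < w" and "w < 2"
    and "prob_space M"
    and "grabp_process M A b t I x0
           (\<lambda>k \<omega>. adaptive_stepsize w A b (I (sel k \<omega>)) (X k \<omega>)) p sel X"
  shows "prob_space.expectation M
           (\<lambda>\<omega>. (norm (X k \<omega> - closest_point (feasible A b) (X k \<omega>)))\<^sup>2)
         \<le> (1 - (2 * w - w\<^sup>2) / (zeta A t I * L\<^sup>2 * (fro_norm A)\<^sup>2)) ^ k *
             (norm (x0 - closest_point (feasible A b) x0))\<^sup>2"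
proof -
  interpret prob_space M by fact
  have sel: "\<And>k. sel k \<in> measurable M (count_space UNIV)"
    and X0: "\<And>\<omega>. \<omega> \<in> space M \<Longrightarrow> X 0 \<omega> = x0"
    and XS: "\<And>k \<omega>. \<omega> \<in> space M \<Longrightarrow> X (Suc k) \<omega> =
         grabp_step A b (I (sel k \<omega>)) (adaptive_stepsize w A b (I (sel k \<omega>)) (X k \<omega>)) (X k \<omega>)"
    using assms(8) unfolding grabp_process_def by blast+
  define d where "d x = (norm (x - closest_point (feasible A b) x))\<^sup>2" for x
  define \<rho> where "\<rho> = 1 - (2 * w - w\<^sup>2) / (zeta A t I * L\<^sup>2 * (fro_norm A)\<^sup>2)"
  have "AE \<omega> in M. \<forall>j. X j \<omega> \<notin> feasible A b \<longrightarrow> sel j \<omega> \<in> greedy_set A b t I (X j \<omega>)"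
    unfolding AE_all_countable
    using grabp_process_selects_greedy[OF assms(7,8)] by blast
  then have decay: "AE \<omega> in M. d (X k \<omega>) \<le> \<rho> ^ k * d x0"
    using AE_space
  proof eventually_elim
    case (elim \<omega>)
    have "d (X (Suc j) \<omega>) \<le> \<rho> * d (X j \<omega>)" for j
      unfolding XS[OF elim(2)] d_def \<rho>_def
      using assms(1-6) elim(1) by (intro grabp_step_contraction) auto
    then have "d (X k \<omega>) \<le> \<rho> ^ k * d (X 0 \<omega>)"
      by (intro geometric_decay[of "\<lambda>j. d (X j \<omega>)"]) (auto simp: d_def)
    then show ?case by (simp add: X0 elim(2))
  qed
  have "(\<lambda>\<omega>. d (X k \<omega>)) \<in> borel_measurable M"
  proof (rule measurableI)
    fix B :: "real set"
    have "{\<omega>\<in>space M. X k \<omega> \<in> d -` B} \<in> sets (past M sel k)"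
      by (rule grabp_iterate_event_in_past[OF assms(8)])
    then show "(\<lambda>\<omega>. d (X k \<omega>)) -` B \<inter> space M \<in> sets M"
      using subalgebra_past[of sel M k, OF sel]
      by (auto simp: subalgebra_def vimage_def Int_def conj_commute)
  qed simp
  then have "integrable M (\<lambda>\<omega>. d (X k \<omega>))"
    using decay by (intro integrable_const_bound[where B = "\<rho> ^ k * d x0"]) (auto simp: d_def)
  then have "expectation (\<lambda>\<omega>. d (X k \<omega>)) \<le> \<rho> ^ k * d x0"
    using decay by (rule integral_le_const)
  then show ?thesis by (simp add: d_def \<rho>_def)
qed

end
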